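(* Let $q\in(0,1)$, let $n\ge 0$ be an integer, and let $g_i,h_i\in A^2(\mathbb{D})$ for $i\in\{0,1,\dots,n\}$ with power series $g_i(z)=\sum_{m=0}^\infty a_{i,m}z^m$ and $h_i(z)=\sum_{m=0}^\infty b_{i,m}z^m$. Let $T$ be the finite rank operator on $A^2(\mathbb{D})$ given by $T(f)=\sum_{i=0}^n\langle f,g_i\rangle h_i$. If $a_{i,m},b_{i,m}\in\mathbb{R}$ for all $i,m$, then the $q$-Berezin range $\mathbf{Ber}_q(T)$ is symmetric about the real axis.
   Context: $\mathbb{D}$ is the open unit disk; $A^2(\mathbb{D})$ is the Bergman space of holomorphic $f$ on $\mathbb{D}$ with $\int_{\mathbb{D}}|f|^2dA<\infty$, $dA$ being area measure normalized so that $\mathbb{D}$ has area $1$. Its reproducing kernel is $k_\lambda(z)=(1-\overline\lambda z)^{-2}$ and its normalized reproducing kernel is $\hat k_\lambda(z)=\frac{1-|\lambda|^2}{(1-\overline\lambda z)^2}$, $\lambda,z\in\mathbb{D}$. For a bounded operator $T$ on $A^2(\mathbb{D})$, $\mathbf{Ber}_q(T)=\{\langle T\hat k_\lambda,\hat k_\mu\rangle:\lambda,\mu\in\mathbb{D},\ \langle\hat k_\lambda,\hat k_\mu\rangle=q\}$. *)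

theory Defs
  imports "HOL-Analysis.Analysis"
begin

abbreviation unit_disk :: "complex set"
  where "unit_disk \<equiv> ball 0 1"

text \<open>
  Elements of the Bergman space are represented by functions on all of \<open>\<complex>\<close>; their values
  outside the disk are irrelevant, since every notion below looks only at the disk.
\<close>

definition bergman_space :: "(complex \<Rightarrow> complex) set"
  where "bergman_space =
    {f. f holomorphic_on unit_disk \<and> set_integrable lborel unit_disk (\<lambda>z. (cmod (f z))\<^sup>2)}"

text \<open>The factor \<open>1 / \<pi>\<close> normalizes area measure so that the disk has area 1.\<close>

definition bergman_inner :: "(complex \<Rightarrow> complex) \<Rightarrow> (complex \<Rightarrow> complex) \<Rightarrow> complex"
  where "bergman_inner f g =
    (1 / complex_of_real pi) * (LINT z:unit_disk|lborel. f z * cnj (g z))"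

definition normalized_kernel :: "complex \<Rightarrow> complex \<Rightarrow> complex"
  where "normalized_kernel l z = complex_of_real (1 - (cmod l)\<^sup>2) / (1 - cnj l * z)\<^sup>2"

definition q_berezin_range ::
    "complex \<Rightarrow> ((complex \<Rightarrow> complex) \<Rightarrow> (complex \<Rightarrow> complex)) \<Rightarrow> complex set"
  where "q_berezin_range q T =
    {bergman_inner (T (normalized_kernel l)) (normalized_kernel m) | l m.
       l \<in> unit_disk \<and> m \<in> unit_disk \<and>
       bergman_inner (normalized_kernel l) (normalized_kernel m) = q}"

definition symmetric_about_real_axis :: "complex set \<Rightarrow> bool"
  where "symmetric_about_real_axis S \<longleftrightarrow> cnj ` S = S"

end

theory Submission
  imports Defs
begin

text \<open>
  Conjugation \<open>z \<mapsto> cnj z\<close> preserves area measure and the disk, so the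
  anti-linear involution \<open>f \<mapsto> (\<lambda>z. cnj (f (cnj z)))\<close> conjugates Bergman inner
  products. It fixes functions with real Taylor coefficients and maps the normalized kernel at
  \<open>l\<close> to the one at \<open>cnj l\<close>; hence it commutes with \<open>T\<close>, and the pair
  \<open>(cnj l, cnj m)\<close> contributes the conjugate of the value contributed by \<open>(l, m)\<close>. The
  constraint on \<open>(l, m)\<close> is preserved because \<open>q\<close> is real.
\<close>

text \<open>In the real basis 1, i conjugation is diagonal with entries 1 and -1, so the absolute
  value of its Jacobian is 1.\<close>

lemma distr_lborel_cnj: "distr lborel borel cnj = lborel"
proof -
  define c :: "complex \<Rightarrow> real" where "c j = (if j = 1 then 1 else -1)" for j
  have cnj_eq: "cnj = (\<lambda>x. 0 + (\<Sum>j\<in>Basis. (c j * (x \<bullet> j)) *\<^sub>R j))"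
    by (rule ext) (simp add: Basis_complex_def c_def complex_eq_iff)
  have prod: "(\<Prod>j\<in>Basis. \<bar>c j\<bar>) = 1"
    by (intro prod.neutral) (simp add: c_def)
  have "lborel = density (distr lborel borel cnj) (\<lambda>_. ennreal (\<Prod>j\<in>Basis. \<bar>c j\<bar>))"
    unfolding cnj_eq by (rule lborel_affine_euclidean) (simp add: c_def)
  also have "\<dots> = distr lborel borel cnj"
    by (simp only: prod ennreal_1 density_1)
  finally show ?thesis by (rule sym)
qed

lemma borel_measurable_cnj: "cnj \<in> borel_measurable borel"
  by (intro borel_measurable_continuous_onI continuous_intros)

lemma lborel_integral_cnj_arg:
  fixes F :: "complex \<Rightarrow> complex"
  shows "(LINT z|lborel. F (cnj z)) = (LINT z|lborel. F z)"
proof (cases "F \<in> borel_measurable lborel")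
  case True
  then show ?thesis
    using integral_distr[of cnj lborel borel F] by (simp add: distr_lborel_cnj borel_measurable_cnj)
next
  \<comment> \<open>Both integrals now take the default value 0: \<open>F\<close> is recovered from
    \<open>F \<circ> cnj\<close> by composing with \<open>cnj\<close> again, so neither function is
    measurable.\<close>
  case False
  have "(\<lambda>z. F (cnj z)) \<notin> borel_measurable lborel"
  proof
    assume "(\<lambda>z. F (cnj z)) \<in> borel_measurable lborel"
    with False show False
      using measurable_compose[OF borel_measurable_cnj, of "\<lambda>z. F (cnj z)" borel] by simp
  qed
  then have "\<not> integrable lborel (\<lambda>z. F (cnj z))" "\<not> integrable lborel F"
    using False borel_measurable_integrable by blast+
  then show ?thesis
    by (simp add: not_integrable_integral_eq)
qed

text \<open>Separate partners \<open>f'\<close> and \<open>g'\<close> let one statement serve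
  kernels at conjugate parameters, functions that are their own partner, and images under
  \<open>T\<close>, whose values are known only on the disk.\<close>

lemma bergman_inner_cnj:
  assumes "\<And>z. z \<in> unit_disk \<Longrightarrow> f' (cnj z) = cnj (f z)"
    and "\<And>z. z \<in> unit_disk \<Longrightarrow> g' (cnj z) = cnj (g z)"
  shows "bergman_inner f' g' = cnj (bergman_inner f g)"
proof -
  have "(LINT z:unit_disk|lborel. f' z * cnj (g' z))
      = (LINT z|lborel. indicator unit_disk (cnj z) *\<^sub>R (f' (cnj z) * cnj (g' (cnj z))))"
    unfolding set_lebesgue_integral_def by (rule lborel_integral_cnj_arg[symmetric])
  \<comment> \<open>Off the disk both integrands vanish, since \<open>cnj z\<close> lies in the disk
    exactly when \<open>z\<close> does.\<close>
  also have "\<dots> = (LINT z|lborel. cnj (indicator unit_disk z *\<^sub>R (f z * cnj (g z))))"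
    using assms by (intro Bochner_Integration.integral_cong) (auto simp: indicator_def)
  also have "\<dots> = cnj (LINT z:unit_disk|lborel. f z * cnj (g z))"
    unfolding set_lebesgue_integral_def by (rule Bochner_Integration.integral_cnj)
  finally show ?thesis
    by (simp add: bergman_inner_def)
qed

text \<open>Termwise conjugation leaves real coefficients alone, so the series at
  \<open>cnj z\<close> converges to both values.\<close>

lemma sums_real_coeffs_cnj:
  assumes "\<And>z. z \<in> unit_disk \<Longrightarrow> (\<lambda>m. c m * z ^ m) sums f z"
    and "\<And>m. c m \<in> \<real>" and "z \<in> unit_disk"
  shows "f (cnj z) = cnj (f z)"
proof (rule sums_unique2)
  show "(\<lambda>m. c m * cnj z ^ m) sums f (cnj z)"
    using assms by simp
  have "(\<lambda>m. cnj (c m * z ^ m)) sums cnj (f z)"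
    using assms by (simp only: sums_cnj)
  then show "(\<lambda>m. c m * cnj z ^ m) sums cnj (f z)"
    using assms(2) by (simp add: Reals_cnj_iff)
qed

lemma normalized_kernel_cnj: "normalized_kernel (cnj l) (cnj z) = cnj (normalized_kernel l z)"
  by (simp add: normalized_kernel_def)

text \<open>Gives access to the formula for \<open>T\<close>, assumed only on
  \<open>bergman_space\<close>. The denominator has no zero on the closed disk, so the kernel is
  continuous on a compact set and hence square integrable.\<close>

lemma normalized_kernel_in_bergman_space:
  assumes "l \<in> unit_disk"
  shows "normalized_kernel l \<in> bergman_space"
proof -
  have nz: "1 - cnj l * z \<noteq> 0" if "z \<in> cball 0 1" for z
  proof -
    have "cmod (cnj l * z) \<le> cmod l"
      using that by (simp add: norm_mult mult_left_le)
    also have "\<dots> < 1"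
      using assms by simp
    finally show ?thesis by auto
  qed
  have "normalized_kernel l holomorphic_on unit_disk"
    unfolding normalized_kernel_def[abs_def]
    by (intro holomorphic_intros) (use nz in auto)
  moreover have "continuous_on (cball 0 1) (\<lambda>z. (cmod (normalized_kernel l z))\<^sup>2)"
    unfolding normalized_kernel_def[abs_def]
    by (intro continuous_intros) (use nz in auto)
  then have "set_integrable lborel (cball 0 1) (\<lambda>z. (cmod (normalized_kernel l z))\<^sup>2)"
    unfolding set_integrable_def by (intro borel_integrable_compact) auto
  then have "set_integrable lborel unit_disk (\<lambda>z. (cmod (normalized_kernel l z))\<^sup>2)"
    by (rule set_integrable_subset) auto
  ultimately show ?thesis
    by (simp add: bergman_space_def)
qed

theorem theorem3p3:
  fixes q :: real and n :: nat
    and g h :: "nat \<Rightarrow> complex \<Rightarrow> complex"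
    and a b :: "nat \<Rightarrow> nat \<Rightarrow> complex"
    and T :: "(complex \<Rightarrow> complex) \<Rightarrow> (complex \<Rightarrow> complex)"
  assumes "q \<in> {0<..<1}"
    and "\<And>i. i \<in> {0..n} \<Longrightarrow> g i \<in> bergman_space"
    and "\<And>i. i \<in> {0..n} \<Longrightarrow> h i \<in> bergman_space"
    and "\<And>i z. i \<in> {0..n} \<Longrightarrow> z \<in> unit_disk \<Longrightarrow> (\<lambda>m. a i m * z ^ m) sums g i z"
    and "\<And>i z. i \<in> {0..n} \<Longrightarrow> z \<in> unit_disk \<Longrightarrow> (\<lambda>m. b i m * z ^ m) sums h i z"
    and "\<And>f z. f \<in> bergman_space \<Longrightarrow> z \<in> unit_disk \<Longrightarrow>
           T f z = (\<Sum>i=0..n. bergman_inner f (g i) * h i z)"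
    and "\<And>i m. i \<in> {0..n} \<Longrightarrow> a i m \<in> \<real>"
    and "\<And>i m. i \<in> {0..n} \<Longrightarrow> b i m \<in> \<real>"
  shows "symmetric_about_real_axis (q_berezin_range (complex_of_real q) T)"
proof -
  have T_kernel: "T (normalized_kernel (cnj l)) (cnj z) = cnj (T (normalized_kernel l) z)"
    if l: "l \<in> unit_disk" and z: "z \<in> unit_disk" for l z
  proof -
    \<comment> \<open>Real coefficients make \<open>g i\<close> its own partner in
      \<open>bergman_inner_cnj\<close>.\<close>
    have "bergman_inner (normalized_kernel (cnj l)) (g i)
        = cnj (bergman_inner (normalized_kernel l) (g i))" if "i \<in> {0..n}" for i
      using assms(4,7) that
      by (intro bergman_inner_cnj normalized_kernel_cnj) (rule sums_real_coeffs_cnj)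
    moreover have "h i (cnj z) = cnj (h i z)" if "i \<in> {0..n}" for i
      using assms(5,8) that z by (intro sums_real_coeffs_cnj)
    ultimately show ?thesis
      using l z by (simp add: assms(6) normalized_kernel_in_bergman_space)
  qed
  let ?S = "q_berezin_range (complex_of_real q) T"
  have "cnj w \<in> ?S" if "w \<in> ?S" for w
  proof -
    from that obtain l m where lm: "l \<in> unit_disk" "m \<in> unit_disk"
      and q: "bergman_inner (normalized_kernel l) (normalized_kernel m) = complex_of_real q"
      and w: "w = bergman_inner (T (normalized_kernel l)) (normalized_kernel m)"
      unfolding q_berezin_range_def by blast
    have "bergman_inner (normalized_kernel (cnj l)) (normalized_kernel (cnj m)) = complex_of_real q"
      using bergman_inner_cnj[of "normalized_kernel (cnj l)" "normalized_kernel l"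
          "normalized_kernel (cnj m)" "normalized_kernel m"] q
      by (simp add: normalized_kernel_cnj)
    moreover have "bergman_inner (T (normalized_kernel (cnj l))) (normalized_kernel (cnj m)) = cnj w"
      unfolding w by (intro bergman_inner_cnj T_kernel lm normalized_kernel_cnj)
    ultimately show ?thesis
      using lm unfolding q_berezin_range_def
      by (intro CollectI exI[of _ "cnj l"] exI[of _ "cnj m"]) auto
  qed
  \<comment> \<open>Since \<open>cnj\<close> is an involution, mapping \<open>?S\<close> into itself
    already gives equality.\<close>
  then show ?thesis
    unfolding symmetric_about_real_axis_def
    by (metis complex_cnj_cnj image_eqI image_subsetI subsetI subset_antisym)
qed

end
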